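(* Consider an $s$-stage explicit Runge--Kutta method of linear order $p$, with coefficients $\alpha_k$ ($\alpha_k=0$ for $k>s$), energy-equality coefficients $\beta_k,\gamma_{i,j}$ and leading index $k^*$. Then $\beta_0=1$. Furthermore: (i) If $p$ is odd, then $$k^*=\frac{p+1}{2},\qquad \beta_{k^*}=(-1)^{k^*}\,2\left(\alpha_{p+1}-\frac{1}{(p+1)!}\right),$$ $$\gamma_{i,j}=-\frac{1}{i!\,j!\,(i+j+1)}\qquad\text{for all }0\le i,j\le k^*-1.$$ (ii) If $p$ is even, then $$k^*\ge\frac p2+1,\qquad \beta_{\frac p2+1}=(-1)^{\frac p2+1}\,2\left(\alpha_{p+2}-\alpha_{p+1}+\frac{1}{p!\,(p+2)}\right),$$ $$\gamma_{i,j}=-\frac{1}{i!\,j!\,(i+j+1)}+\iota_{i,j,p}\qquad\text{for all }0\le i,j\le\frac p2,$$ where $\iota_{i,j,p}=(-1)^{\frac p2+1}\left(\alpha_{p+1}-\frac1{(p+1)!}\right)$ if $i=j=\frac p2$, and $\iota_{i,j,p}=0$ otherwise.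
   Context: An explicit $s$-stage Runge--Kutta (RK) method ($s\ge 1$) applied to the linear autonomous system $\frac{d}{dt}u=Lu$, $u\in\mathbb{R}^N$, $L\in\mathbb{R}^{N\times N}$, with time step $\tau>0$ takes the form $u^{n+1}=R_s u^n$, where $R_s=\sum_{k=0}^s\alpha_k(\tau L)^k$ with real coefficients $\alpha_k$ depending only on the method, $\alpha_0=1$, $\alpha_s\ne 0$. Set $\alpha_k=0$ for $k>s$. The method has linear order $p\ge1$ if $\alpha_k=\frac1{k!}$ for $0\le k\le p$ and $\alpha_{p+1}\neq\frac{1}{(p+1)!}$ (so $p\le s$). For a real symmetric positive definite $N\times N$ matrix $H$, let $\langle v,w\rangle_H=\langle v,Hw\rangle$ ($\langle\cdot,\cdot\rangle$ the Euclidean inner product) and $\|v\|_H=\sqrt{\langle v,v\rangle_H}$. $L$ is semi-negative (with respect to $H$) if $L^\top H+HL\le 0$, i.e. is negative semi-definite; then put $[v,w]_H=-\langle v,(L^\top H+HL)w\rangle$. Energy equality: there are unique real coefficients $\{\beta_k\}_{k=0}^s$ and $\{\gamma_{i,j}\}_{i,j=0}^{s-1}$ with $\gamma_{i,j}=\gamma_{j,i}$, depending only on $\alpha_0,\dots,\alpha_s$, such that for all $N$, $H$ symmetric positive definite, $L$ semi-negative with respect to $H$, $u\in\mathbb{R}^N$ and $\tau$, $$\|R_su\|_H^2=\sum_{k=0}^s\beta_k\tau^{2k}\|L^ku\|_H^2+\sum_{i,j=0}^{s-1}\gamma_{i,j}\tau^{i+j+1}[L^iu,L^ju]_H .$$ The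 leading index $k^*$ is the positive integer with $\beta_{k^*}\ne0$ and $\beta_k=0$ for all $1\le k<k^*$ (it exists and $k^*\le s$, since $\beta_s=\alpha_s^2\neq0$). *)

theory Defs
  imports Complex_Main "Jordan_Normal_Form.Matrix"
begin

(* The energy equality quantifies over all dimensions N, so vectors and matrices are those of
   Jordan_Normal_Form, whose dimension is a natural number rather than a type. *)

definition sym_pos_def :: "nat \<Rightarrow> real mat \<Rightarrow> bool" where
  "sym_pos_def N H \<longleftrightarrow>
     H \<in> carrier_mat N N \<and> transpose_mat H = H \<and>
     (\<forall>v \<in> carrier_vec N. v \<noteq> 0\<^sub>v N \<longrightarrow> v \<bullet> (H *\<^sub>v v) > 0)"

definition inner_H :: "real mat \<Rightarrow> real vec \<Rightarrow> real vec \<Rightarrow> real" where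
  "inner_H H v w = v \<bullet> (H *\<^sub>v w)"

definition norm_H :: "real mat \<Rightarrow> real vec \<Rightarrow> real" where
  "norm_H H v = sqrt (inner_H H v v)"

definition semi_negative :: "nat \<Rightarrow> real mat \<Rightarrow> real mat \<Rightarrow> bool" where
  "semi_negative N H L \<longleftrightarrow>
     L \<in> carrier_mat N N \<and>
     (\<forall>v \<in> carrier_vec N. v \<bullet> ((transpose_mat L * H + H * L) *\<^sub>v v) \<le> 0)"

definition bracket_H :: "real mat \<Rightarrow> real mat \<Rightarrow> real vec \<Rightarrow> real vec \<Rightarrow> real" where
  "bracket_H H L v w = - (v \<bullet> ((transpose_mat L * H + H * L) *\<^sub>v w))"

(* An explicit s-stage Runge-Kutta method enters only through the coefficients of its stability
   polynomial, extended by zero beyond s. *)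
definition explicit_RK :: "nat \<Rightarrow> (nat \<Rightarrow> real) \<Rightarrow> bool" where
  "explicit_RK s \<alpha> \<longleftrightarrow> s \<ge> 1 \<and> \<alpha> 0 = 1 \<and> \<alpha> s \<noteq> 0 \<and> (\<forall>k>s. \<alpha> k = 0)"

definition has_linear_order :: "(nat \<Rightarrow> real) \<Rightarrow> nat \<Rightarrow> bool" where
  "has_linear_order \<alpha> p \<longleftrightarrow>
     p \<ge> 1 \<and> (\<forall>k\<le>p. \<alpha> k = 1 / fact k) \<and> \<alpha> (p + 1) \<noteq> 1 / fact (p + 1)"

(* The matrix sum of the terms \<alpha> k (\<tau> L)^k over k \<le> s, written entrywise because matrices of
   varying dimension have no type-class addition that could be summed. *)
definition RK_matrix :: "nat \<Rightarrow> nat \<Rightarrow> (nat \<Rightarrow> real) \<Rightarrow> real \<Rightarrow> real mat \<Rightarrow> real mat" where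
  "RK_matrix N s \<alpha> \<tau> L =
     mat N N (\<lambda>ij. \<Sum>k\<le>s. (\<alpha> k \<cdot>\<^sub>m ((\<tau> \<cdot>\<^sub>m L) ^\<^sub>m k)) $$ ij)"

(* Only the values of \<beta> on {0..s} and of \<gamma> on {0..s-1} x {0..s-1} are meaningful, and they are
   determined uniquely by this property. *)
definition energy_equality ::
  "nat \<Rightarrow> (nat \<Rightarrow> real) \<Rightarrow> (nat \<Rightarrow> real) \<Rightarrow> (nat \<Rightarrow> nat \<Rightarrow> real) \<Rightarrow> bool" where
  "energy_equality s \<alpha> \<beta> \<gamma> \<longleftrightarrow>
     (\<forall>i<s. \<forall>j<s. \<gamma> i j = \<gamma> j i) \<and>
     (\<forall>N H L u \<tau>. sym_pos_def N H \<longrightarrow> semi_negative N H L \<longrightarrow> u \<in> carrier_vec N \<longrightarrow> \<tau> > 0 \<longrightarrow>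
        (norm_H H (RK_matrix N s \<alpha> \<tau> L *\<^sub>v u))\<^sup>2 =
          (\<Sum>k\<le>s. \<beta> k * \<tau> ^ (2 * k) * (norm_H H ((L ^\<^sub>m k) *\<^sub>v u))\<^sup>2) +
          (\<Sum>i<s. \<Sum>j<s. \<gamma> i j * \<tau> ^ (i + j + 1) *
             bracket_H H L ((L ^\<^sub>m i) *\<^sub>v u) ((L ^\<^sub>m j) *\<^sub>v u)))"

definition leading_index :: "nat \<Rightarrow> (nat \<Rightarrow> real) \<Rightarrow> nat" where
  "leading_index s \<beta> =
     (THE k. 1 \<le> k \<and> k \<le> s \<and> \<beta> k \<noteq> 0 \<and> (\<forall>j. 1 \<le> j \<and> j < k \<longrightarrow> \<beta> j = 0))"

definition iota :: "(nat \<Rightarrow> real) \<Rightarrow> nat \<Rightarrow> nat \<Rightarrow> nat \<Rightarrow> real" where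
  "iota \<alpha> p i j =
     (if i = p div 2 \<and> j = p div 2
      then (-1) ^ (p div 2 + 1) * (\<alpha> (p + 1) - 1 / fact (p + 1)) else 0)"

end

theory Submission
  imports Defs
begin

text \<open>Two-dimensional test problems already determine the coefficients. Take \<open>L = diag(x, y)\<close> with
  \<open>x, y < 0\<close>, \<open>u = (1, 1)\<close>, \<open>\<tau> = 1\<close>, and \<open>H\<close> with unit diagonal and off-diagonal entry \<open>e\<close>. For small
  \<open>\<bar>e\<bar>\<close> this is admissible, and the part of the energy equality that is odd in \<open>e\<close> reads
  \<open>R(x) R(y) = (\<Sum>k. \<beta>\<^sub>k (x y)^k) - (x + y) (\<Sum>i j. \<gamma>\<^sub>i\<^sub>j x^i y^j)\<close>.
  Comparing coefficients gives \<open>\<alpha>\<^sub>i \<alpha>\<^sub>j = \<delta>\<^sub>i\<^sub>j \<beta>\<^sub>i - \<gamma>\<^sub>i\<^sub>-\<^sub>1\<^sub>,\<^sub>j - \<gamma>\<^sub>i\<^sub>,\<^sub>j\<^sub>-\<^sub>1\<close>, which is solved along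
  antidiagonals, starting from \<open>\<gamma>\<^sub>i\<^sub>,\<^sub>0 = -\<alpha>\<^sub>i\<^sub>+\<^sub>1\<close>; the diagonal equations then yield the \<open>\<beta>\<^sub>k\<close>.\<close>

section \<open>Two-dimensional test problems\<close>

definition diag2 :: "real \<Rightarrow> real \<Rightarrow> real mat" where
  "diag2 x y = mat 2 2 (\<lambda>(i, j). if i = j then (if i = 0 then x else y) else 0)"

definition gram2 :: "real \<Rightarrow> real mat" where
  "gram2 e = mat 2 2 (\<lambda>(i, j). if i = j then 1 else e)"

definition vec2 :: "real \<Rightarrow> real \<Rightarrow> real vec" where
  "vec2 a b = vec 2 (\<lambda>i. if i = 0 then a else b)"

lemma sum_less_two: "(\<Sum>i = 0..<(2::nat). f i) = f 0 + (f 1 :: real)"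
  by (simp add: numeral_2_eq_2)

lemma vec2_carrier [simp]: "vec2 a b \<in> carrier_vec 2"
  by (simp add: vec2_def)

lemma diag2_carrier [simp]: "diag2 x y \<in> carrier_mat 2 2"
  by (simp add: diag2_def)

lemma gram2_carrier [simp]: "gram2 e \<in> carrier_mat 2 2"
  by (simp add: gram2_def)

lemma vec2_cases:
  assumes "v \<in> carrier_vec 2"
  obtains a b where "v = vec2 a b"
proof
  show "v = vec2 (v $ 0) (v $ 1)"
    using assms by (auto simp: vec2_def less_2_cases_iff)
qed

lemma vec2_eq_zero_iff: "vec2 a b = 0\<^sub>v 2 \<longleftrightarrow> a = 0 \<and> b = 0"
  by (auto simp: vec2_def vec_eq_iff less_2_cases_iff)

lemma diag2_mult: "diag2 a b * diag2 c d = diag2 (a * c) (b * d)"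
  by (rule eq_matI) (auto simp: diag2_def scalar_prod_def sum_less_two less_2_cases_iff)

lemma diag2_power: "diag2 x y ^\<^sub>m k = diag2 (x ^ k) (y ^ k)"
proof (induction k)
  case 0
  show ?case by (auto simp: diag2_def one_mat_def intro!: eq_matI)
next
  case (Suc k)
  then show ?case by (simp add: diag2_mult mult.commute)
qed

lemma diag2_mult_vec2: "diag2 x y *\<^sub>v vec2 a b = vec2 (x * a) (y * b)"
  by (rule eq_vecI) (auto simp: diag2_def vec2_def scalar_prod_def sum_less_two less_2_cases_iff)

lemma smult_one_mat: "(1::real) \<cdot>\<^sub>m A = A"
  by (rule eq_matI) auto

lemma RK_matrix_diag2:
  "RK_matrix 2 s \<alpha> 1 (diag2 x y) = diag2 (\<Sum>k\<le>s. \<alpha> k * x ^ k) (\<Sum>k\<le>s. \<alpha> k * y ^ k)"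
  unfolding RK_matrix_def smult_one_mat diag2_power
  by (rule eq_matI) (auto simp: diag2_def less_2_cases_iff)

lemma inner_H_gram2:
  "inner_H (gram2 e) (vec2 a b) (vec2 c d) = a * c + b * d + e * (a * d + b * c)"
  by (simp add: inner_H_def gram2_def vec2_def scalar_prod_def sum_less_two algebra_simps)

lemma bracket_H_gram2:
  "bracket_H (gram2 e) (diag2 x y) (vec2 a b) (vec2 c d) =
     - (2 * x * a * c + 2 * y * b * d + e * (x + y) * (a * d + b * c))"
  by (simp add: bracket_H_def gram2_def diag2_def vec2_def scalar_prod_def sum_less_two algebra_simps)

text \<open>The mixed term is controlled by \<open>2 * |a * b| <= a^2 + b^2\<close>; the constant
  \<open>1 - |e|\<close> is the smaller eigenvalue of \<open>gram2 e\<close>.\<close>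

lemma inner_H_gram2_lower_bound:
  assumes "\<bar>e\<bar> < 1"
  shows "inner_H (gram2 e) (vec2 a b) (vec2 a b) \<ge> (1 - \<bar>e\<bar>) * (a\<^sup>2 + b\<^sup>2)"
proof -
  have "\<bar>e * (2 * (a * b))\<bar> \<le> \<bar>e\<bar> * (a\<^sup>2 + b\<^sup>2)"
  proof -
    have "\<bar>2 * (a * b)\<bar> \<le> a\<^sup>2 + b\<^sup>2"
      using sum_squares_bound[of a b] sum_squares_bound[of a "- b"] by (simp add: abs_le_iff mult.assoc)
    then show ?thesis unfolding abs_mult[of e] by (intro mult_left_mono) auto
  qed
  then show ?thesis
    by (simp add: inner_H_gram2 abs_le_iff power2_eq_square algebra_simps)
qed

lemma sym_pos_def_gram2:
  assumes "\<bar>e\<bar> < 1"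
  shows "sym_pos_def 2 (gram2 e)"
  unfolding sym_pos_def_def
proof (intro conjI ballI impI)
  show "transpose_mat (gram2 e) = gram2 e"
    by (rule eq_matI) (auto simp: gram2_def)
  fix v :: "real vec"
  assume v: "v \<in> carrier_vec 2" "v \<noteq> 0\<^sub>v 2"
  obtain a b where ab: "v = vec2 a b" using vec2_cases[OF v(1)] .
  with v have "a\<^sup>2 + b\<^sup>2 > 0"
    by (auto simp: vec2_eq_zero_iff sum_power2_gt_zero_iff)
  with assms have "0 < (1 - \<bar>e\<bar>) * (a\<^sup>2 + b\<^sup>2)" by simp
  also have "\<dots> \<le> inner_H (gram2 e) v v" using inner_H_gram2_lower_bound[OF assms] ab by simp
  finally show "v \<bullet> (gram2 e *\<^sub>v v) > 0" by (simp add: inner_H_def)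
qed simp

lemma norm_H_gram2_square:
  assumes "\<bar>e\<bar> < 1"
  shows "(norm_H (gram2 e) (vec2 a b))\<^sup>2 = a\<^sup>2 + b\<^sup>2 + 2 * e * (a * b)"
proof -
  have "0 \<le> (1 - \<bar>e\<bar>) * (a\<^sup>2 + b\<^sup>2)" using assms by simp
  then have "0 \<le> inner_H (gram2 e) (vec2 a b) (vec2 a b)"
    using inner_H_gram2_lower_bound[OF assms] order_trans by blast
  then show ?thesis
    by (simp add: norm_H_def inner_H_gram2 power2_eq_square algebra_simps)
qed

text \<open>The symmetric matrix to be tested has diagonal entries \<open>2 * x\<close>,
  \<open>2 * y\<close> and off-diagonal entry \<open>e * (x + y)\<close>. Hypothesis
  \<open>le\<close> says that its determinant is nonnegative, so completing the square and dividing
  by \<open>2 * x < 0\<close> gives the sign.\<close>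

lemma semi_negative_diag2:
  assumes "x < 0" and le: "e\<^sup>2 * (x + y)\<^sup>2 \<le> 4 * x * y"
  shows "semi_negative 2 (gram2 e) (diag2 x y)"
  unfolding semi_negative_def
proof (intro conjI ballI)
  fix v :: "real vec"
  assume v: "v \<in> carrier_vec 2"
  obtain a b where ab: "v = vec2 a b" using vec2_cases[OF v] .
  define q where "q = 2 * x * a * a + 2 * y * b * b + e * (x + y) * (a * b + b * a)"
  have "2 * x * q = (2 * x * a + e * (x + y) * b)\<^sup>2 + (4 * x * y - e\<^sup>2 * (x + y)\<^sup>2) * b\<^sup>2"
    by (simp add: q_def power2_eq_square algebra_simps)
  moreover have "\<dots> \<ge> 0" using le by simp
  ultimately have "0 \<le> 2 * x * q" by linarith
  with \<open>x < 0\<close> have "q \<le> 0" by (auto simp: zero_le_mult_iff)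
  moreover have "v \<bullet> ((transpose_mat (diag2 x y) * gram2 e + gram2 e * diag2 x y) *\<^sub>v v) = q"
    using bracket_H_gram2[of e x y a b a b] by (simp add: ab q_def bracket_H_def)
  ultimately show "v \<bullet> ((transpose_mat (diag2 x y) * gram2 e + gram2 e * diag2 x y) *\<^sub>v v) \<le> 0"
    by simp
qed simp

section \<open>The polynomial identity extracted from the energy equality\<close>

text \<open>Sorts the energy equality by powers of \<open>e\<close>: only the part linear in
  \<open>e\<close> mixes \<open>x\<close> and \<open>y\<close>.\<close>

lemma energy_equality_diag2:
  fixes x y e :: real
  assumes ee: "energy_equality s \<alpha> \<beta> \<gamma>" and "x < 0" and e: "\<bar>e\<bar> < 1"
    and le: "e\<^sup>2 * (x + y)\<^sup>2 \<le> 4 * x * y"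
  defines "r \<equiv> \<lambda>z. \<Sum>k\<le>s. \<alpha> k * z ^ k"
  shows "(r x)\<^sup>2 + (r y)\<^sup>2 + 2 * e * (r x * r y) =
    (\<Sum>k\<le>s. \<beta> k * ((x ^ k)\<^sup>2 + (y ^ k)\<^sup>2)) -
    (\<Sum>i<s. \<Sum>j<s. \<gamma> i j * (2 * x * x ^ i * x ^ j + 2 * y * y ^ i * y ^ j)) +
    e * (2 * (\<Sum>k\<le>s. \<beta> k * (x ^ k * y ^ k)) -
         (x + y) * (\<Sum>i<s. \<Sum>j<s. \<gamma> i j * (x ^ i * y ^ j + y ^ i * x ^ j)))"
proof -
  have "(norm_H (gram2 e) (RK_matrix 2 s \<alpha> 1 (diag2 x y) *\<^sub>v vec2 1 1))\<^sup>2 =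
          (\<Sum>k\<le>s. \<beta> k * 1 ^ (2 * k) * (norm_H (gram2 e) ((diag2 x y ^\<^sub>m k) *\<^sub>v vec2 1 1))\<^sup>2) +
          (\<Sum>i<s. \<Sum>j<s. \<gamma> i j * 1 ^ (i + j + 1) *
             bracket_H (gram2 e) (diag2 x y) ((diag2 x y ^\<^sub>m i) *\<^sub>v vec2 1 1) ((diag2 x y ^\<^sub>m j) *\<^sub>v vec2 1 1))"
    by (rule ee[unfolded energy_equality_def, THEN conjunct2, rule_format])
      (use sym_pos_def_gram2[OF e] semi_negative_diag2[OF \<open>x < 0\<close> le] in auto)
  then have eq: "(r x)\<^sup>2 + (r y)\<^sup>2 + 2 * e * (r x * r y) =
      (\<Sum>k\<le>s. \<beta> k * ((x ^ k)\<^sup>2 + (y ^ k)\<^sup>2 + 2 * e * (x ^ k * y ^ k))) +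
      (\<Sum>i<s. \<Sum>j<s. \<gamma> i j * - (2 * x * x ^ i * x ^ j + 2 * y * y ^ i * y ^ j +
         e * (x + y) * (x ^ i * y ^ j + y ^ i * x ^ j)))"
    unfolding RK_matrix_diag2 diag2_power diag2_mult_vec2 norm_H_gram2_square[OF e]
      bracket_H_gram2 power_one mult_1_right r_def .
  have "(\<Sum>k\<le>s. \<beta> k * ((x ^ k)\<^sup>2 + (y ^ k)\<^sup>2 + 2 * e * (x ^ k * y ^ k))) =
      (\<Sum>k\<le>s. \<beta> k * ((x ^ k)\<^sup>2 + (y ^ k)\<^sup>2)) + e * (2 * (\<Sum>k\<le>s. \<beta> k * (x ^ k * y ^ k)))"
    unfolding sum_distrib_left sum.distrib[symmetric]
    by (rule sum.cong) (simp_all add: algebra_simps)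
  moreover have "(\<Sum>i<s. \<Sum>j<s. \<gamma> i j * - (2 * x * x ^ i * x ^ j + 2 * y * y ^ i * y ^ j +
         e * (x + y) * (x ^ i * y ^ j + y ^ i * x ^ j))) =
      - (\<Sum>i<s. \<Sum>j<s. \<gamma> i j * (2 * x * x ^ i * x ^ j + 2 * y * y ^ i * y ^ j)) -
      e * ((x + y) * (\<Sum>i<s. \<Sum>j<s. \<gamma> i j * (x ^ i * y ^ j + y ^ i * x ^ j)))"
    unfolding sum_distrib_left sum_negf[symmetric] sum_subtractf[symmetric]
    by (intro sum.cong refl) (simp add: algebra_simps)
  ultimately show ?thesis unfolding eq by (simp add: right_diff_distrib)
qed

text \<open>Subtracting the test equality for \<open>- e\<close> from the one for \<open>e\<close>
  cancels all terms in \<open>x\<close> alone or \<open>y\<close> alone.\<close>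

lemma stability_polynomial_identity:
  fixes x y :: real
  assumes ee: "energy_equality s \<alpha> \<beta> \<gamma>" and x: "x < 0" and y: "y < 0"
  shows "(\<Sum>i\<le>s. \<alpha> i * x ^ i) * (\<Sum>j\<le>s. \<alpha> j * y ^ j) =
    (\<Sum>k\<le>s. \<beta> k * (x ^ k * y ^ k)) - (x + y) * (\<Sum>i<s. \<Sum>j<s. \<gamma> i j * (x ^ i * y ^ j))"
proof -
  \<comment> \<open>This value lies strictly between 0 and 1 and makes
    \<open>e^2 * (x + y)^2\<close> equal to \<open>e * (x * y)\<close>, so both signs of
    \<open>e\<close> are admissible.\<close>
  define e where "e = x * y / (x + y)\<^sup>2"
  have xy: "x * y > 0" using x y by (rule mult_neg_neg)
  have xy2: "x * y < (x + y)\<^sup>2"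
    using xy by (simp add: power2_eq_square algebra_simps) (smt (verit) zero_le_square)
  have "e > 0" "e < 1" using xy xy2 by (auto simp: e_def intro!: divide_pos_pos simp: divide_less_eq_1)
  have "e\<^sup>2 * (x + y)\<^sup>2 = e * (x * y)" using xy xy2 by (simp add: e_def power2_eq_square)
  also have "\<dots> \<le> 1 * (x * y)" using \<open>e < 1\<close> xy by (intro mult_right_mono) auto
  also have "\<dots> \<le> 4 * x * y" using xy by linarith
  finally have le: "e\<^sup>2 * (x + y)\<^sup>2 \<le> 4 * x * y" .
  \<comment> \<open>Symmetry of \<gamma> merges the two mixed sums, so that the factor 2 cancels at
    the end.\<close>
  have sym: "(\<Sum>i<s. \<Sum>j<s. \<gamma> i j * (y ^ i * x ^ j)) = (\<Sum>i<s. \<Sum>j<s. \<gamma> i j * (x ^ i * y ^ j))"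
    using ee unfolding energy_equality_def
    by (subst sum.swap) (auto intro!: sum.cong simp: mult_ac)
  define B where "B = (\<Sum>i\<le>s. \<alpha> i * x ^ i) * (\<Sum>j\<le>s. \<alpha> j * y ^ j)"
  define C where "C = 2 * (\<Sum>k\<le>s. \<beta> k * (x ^ k * y ^ k)) -
         (x + y) * (\<Sum>i<s. \<Sum>j<s. \<gamma> i j * (x ^ i * y ^ j + y ^ i * x ^ j))"
  have "\<bar>e\<bar> < 1" "\<bar>- e\<bar> < 1" "(- e)\<^sup>2 * (x + y)\<^sup>2 \<le> 4 * x * y"
    using \<open>e > 0\<close> \<open>e < 1\<close> le by auto
  with le have "2 * (e * B) = e * C"
    using energy_equality_diag2[OF ee x, of e y, folded B_def C_def]
      energy_equality_diag2[OF ee x, of "- e" y, folded B_def C_def] by linarith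
  then have "2 * B = C" using \<open>e > 0\<close> by simp
  then show ?thesis
    by (simp add: B_def C_def distrib_left sum.distrib sym)
qed

section \<open>Comparison of coefficients and the resulting recursion\<close>

text \<open>A polynomial with a nonzero coefficient has finitely many roots, but the negative
  half-line is infinite.\<close>

lemma coeffs_zero_if_zero_on_negatives:
  fixes c :: "nat \<Rightarrow> real"
  assumes "\<And>x. x < 0 \<Longrightarrow> (\<Sum>i\<le>n. c i * x ^ i) = 0" and "i \<le> n"
  shows "c i = 0"
proof (rule ccontr)
  assume "c i \<noteq> 0"
  then have "finite {z. (\<Sum>i\<le>n. c i * z ^ i) = 0}"
    using polyfun_finite_roots assms(2) by metis
  then have "finite {..<0::real}" by (rule rev_finite_subset) (use assms(1) in auto)
  then show False using infinite_Iio by blast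
qed

text \<open>The univariate case is applied in \<open>x\<close> for each fixed \<open>y\<close>, then
  in \<open>y\<close> to the coefficients so obtained.\<close>

lemma coeffs_zero_if_zero_on_negatives2:
  fixes c :: "nat \<Rightarrow> nat \<Rightarrow> real"
  assumes "\<And>x y. x < 0 \<Longrightarrow> y < 0 \<Longrightarrow> (\<Sum>i\<le>m. \<Sum>j\<le>n. c i j * (x ^ i * y ^ j)) = 0"
    and "i \<le> m" and "j \<le> n"
  shows "c i j = 0"
proof -
  have "(\<Sum>j\<le>n. c i j * y ^ j) = 0" if "y < 0" for y
    by (rule coeffs_zero_if_zero_on_negatives[OF _ \<open>i \<le> m\<close>])
      (use assms(1)[OF _ that] in \<open>simp add: sum_distrib_right sum_distrib_left mult_ac\<close>)
  then show ?thesis using coeffs_zero_if_zero_on_negatives \<open>j \<le> n\<close> by metis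
qed

text \<open>Brings the \<gamma>-sums, after multiplication by \<open>x\<close> or \<open>y\<close>,
  to the index range \<open>{..s}\<close> of the \<alpha>- and \<beta>-sums.\<close>

lemma sum_power_shift:
  fixes f :: "nat \<Rightarrow> real"
  shows "x * (\<Sum>i<s. f i * x ^ i) = (\<Sum>i\<le>s. (case i of 0 \<Rightarrow> 0 | Suc k \<Rightarrow> f k) * x ^ i)"
  by (simp add: lessThan_Suc_atMost[symmetric] sum.lessThan_Suc_shift sum_distrib_left mult_ac
      del: sum.lessThan_Suc)

text \<open>Compares the coefficients of \<open>x ^ i * y ^ j\<close> in the polynomial identity.
  Extending \<gamma> by zero to \<open>g\<close> gives the boundary cases \<open>i = s\<close> and
  \<open>j = s\<close> the same form as the others.\<close>

lemma coefficient_equations: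
  assumes ee: "energy_equality s \<alpha> \<beta> \<gamma>"
    and g_def: "\<And>i j. g i j = (if i < s \<and> j < s then \<gamma> i j else 0)"
    and "i \<le> s" "j \<le> s"
  shows "\<alpha> i * \<alpha> j = (if i = j then \<beta> i else 0)
    - (case i of 0 \<Rightarrow> 0 | Suc k \<Rightarrow> g k j) - (case j of 0 \<Rightarrow> 0 | Suc k \<Rightarrow> g i k)"
proof -
  let ?c = "\<lambda>i j. \<alpha> i * \<alpha> j - ((if i = j then \<beta> i else 0)
    - (case i of 0 \<Rightarrow> 0 | Suc k \<Rightarrow> g k j) - (case j of 0 \<Rightarrow> 0 | Suc k \<Rightarrow> g i k))"
  have "?c i j = 0"
  proof (rule coeffs_zero_if_zero_on_negatives2[where m = s and n = s and c = ?c, OF _ \<open>i \<le> s\<close> \<open>j \<le> s\<close>])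
    fix x y :: real
    assume "x < 0" "y < 0"
    define G where "G = (\<Sum>i<s. \<Sum>j<s. \<gamma> i j * (x ^ i * y ^ j))"
    \<comment> \<open>The additional summand \<open>j = s\<close> vanishes because
      \<open>g i s = 0\<close>.\<close>
    have row: "(\<Sum>j<s. \<gamma> i j * y ^ j) = (\<Sum>j\<le>s. g i j * y ^ j)" if "i < s" for i
      using that by (simp add: g_def lessThan_Suc_atMost[symmetric])
    have col: "(\<Sum>i<s. \<gamma> i j * x ^ i) = (\<Sum>i\<le>s. g i j * x ^ i)" if "j < s" for j
      using that by (simp add: g_def lessThan_Suc_atMost[symmetric])
    have "x * G = x * (\<Sum>i<s. (\<Sum>j<s. \<gamma> i j * y ^ j) * x ^ i)"
      by (simp add: G_def sum_distrib_left mult_ac)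
    also have "\<dots> = x * (\<Sum>i<s. (\<Sum>j\<le>s. g i j * y ^ j) * x ^ i)"
      by (simp add: row)
    also have "\<dots> = (\<Sum>i\<le>s. \<Sum>j\<le>s. (case i of 0 \<Rightarrow> 0 | Suc k \<Rightarrow> g k j) * (x ^ i * y ^ j))"
      unfolding sum_power_shift
      by (intro sum.cong refl) (simp add: sum_distrib_left mult_ac split: nat.split)
    finally have xG: "x * G = \<dots>" .
    have "y * G = y * (\<Sum>j<s. (\<Sum>i<s. \<gamma> i j * x ^ i) * y ^ j)"
      unfolding G_def by (subst sum.swap) (simp add: sum_distrib_left mult_ac)
    also have "\<dots> = y * (\<Sum>j<s. (\<Sum>i\<le>s. g i j * x ^ i) * y ^ j)"
      by (simp add: col)
    also have "\<dots> = (\<Sum>j\<le>s. \<Sum>i\<le>s. (case j of 0 \<Rightarrow> 0 | Suc k \<Rightarrow> g i k) * (x ^ i * y ^ j))"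
      unfolding sum_power_shift
      by (intro sum.cong refl) (simp add: sum_distrib_left mult_ac split: nat.split)
    also have "\<dots> = (\<Sum>i\<le>s. \<Sum>j\<le>s. (case j of 0 \<Rightarrow> 0 | Suc k \<Rightarrow> g i k) * (x ^ i * y ^ j))"
      by (rule sum.swap)
    finally have yG: "y * G = \<dots>" .
    have diag: "(\<Sum>i\<le>s. \<Sum>j\<le>s. (if i = j then \<beta> i else 0) * (x ^ i * y ^ j))
        = (\<Sum>k\<le>s. \<beta> k * (x ^ k * y ^ k))"
      by (simp add: if_distrib[of "\<lambda>z. z * _"] cong: if_cong)
    have prod: "(\<Sum>i\<le>s. \<alpha> i * x ^ i) * (\<Sum>j\<le>s. \<alpha> j * y ^ j) =
        (\<Sum>i\<le>s. \<Sum>j\<le>s. \<alpha> i * \<alpha> j * (x ^ i * y ^ j))"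
      by (simp add: sum_product mult_ac)
    show "(\<Sum>i\<le>s. \<Sum>j\<le>s. ?c i j * (x ^ i * y ^ j)) = 0"
      using stability_polynomial_identity[OF ee \<open>x < 0\<close> \<open>y < 0\<close>]
      unfolding G_def[symmetric] distrib_right[of x y G] prod xG yG diag[symmetric]
      by (simp add: left_diff_distrib sum_subtractf)
  qed
  then show ?thesis by simp
qed

text \<open>Along an antidiagonal \<open>i + j = m\<close> the coefficient equations form a two-term recursion with
  particular solution \<open>-1 / (i! j! (m + 1))\<close>; the homogeneous solutions are \<open>(-1)\<^sup>j C\<close>.\<close>

lemma antidiagonal_recursion:
  fixes g :: "nat \<Rightarrow> nat \<Rightarrow> real"
  assumes rec: "\<And>i j. Suc i + j = m \<Longrightarrow> j \<ge> a \<Longrightarrow> j < i \<Longrightarrow>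
      g (Suc i) j + g i (Suc j) = - 1 / (fact (Suc i) * fact (Suc j))"
    and base: "\<And>i. i + a = m \<Longrightarrow> g i a = - 1 / (fact i * fact a * real (m + 1)) + (-1) ^ a * C"
    and "a \<le> j" "j \<le> i" "i + j = m"
  shows "g i j = - 1 / (fact i * fact j * real (m + 1)) + (-1) ^ j * C"
  using \<open>a \<le> j\<close> \<open>j \<le> i\<close> \<open>i + j = m\<close>
proof (induction j arbitrary: i rule: dec_induct)
  case base
  then show ?case using assms(2) by blast
next
  case (step n)
  have IH: "g (Suc i) n = - 1 / (fact (Suc i) * fact n * real (m + 1)) + (-1) ^ n * C"
    using step by simp
  \<comment> \<open>To be used with \<open>a = fact i\<close>, \<open>b = fact n\<close>,
    \<open>x = Suc i\<close>, \<open>y = Suc n\<close>, where \<open>x + y = m + 1\<close>: the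
    particular solution satisfies the recursion.\<close>
  have frac: "- 1 / (x * a * (y * b)) - - 1 / (x * a * b * (x + y)) = - 1 / (a * (y * b) * (x + y))"
    if "a > 0" "b > 0" "x > 0" "y > 0" for a b x y :: real
    using that by (simp add: divide_simps)
  have m: "real (m + 1) = real (Suc i) + real (Suc n)" using step by simp
  have "g (Suc i) n + g i (Suc n) = - 1 / (fact (Suc i) * fact (Suc n))"
    using step by (intro rec) auto
  then have "g i (Suc n) = - 1 / (fact (Suc i) * fact (Suc n)) - g (Suc i) n"
    by (simp only: eq_diff_eq add.commute)
  also have "\<dots> = - 1 / (fact (Suc i) * fact (Suc n)) - - 1 / (fact (Suc i) * fact n * real (m + 1))
      - (-1) ^ n * C"
    unfolding IH by (rule diff_diff_eq[symmetric])
  also have "- 1 / (fact (Suc i) * fact (Suc n)) - - 1 / (fact (Suc i) * fact n * real (m + 1))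
      = (- 1 / (fact i * fact (Suc n) * real (m + 1)) :: real)"
    unfolding fact_Suc m by (rule frac) simp_all
  finally show ?case by (simp del: fact_Suc)
qed

section \<open>The leading index\<close>

lemma leading_index_eqI:
  assumes "1 \<le> k" "k \<le> s" "\<beta> k \<noteq> 0" "\<And>j. 1 \<le> j \<Longrightarrow> j < k \<Longrightarrow> \<beta> j = 0"
  shows "leading_index s \<beta> = k"
  unfolding leading_index_def
proof (rule the_equality)
  show "1 \<le> k \<and> k \<le> s \<and> \<beta> k \<noteq> 0 \<and> (\<forall>j. 1 \<le> j \<and> j < k \<longrightarrow> \<beta> j = 0)"
    using assms by blast
  fix l
  assume l: "1 \<le> l \<and> l \<le> s \<and> \<beta> l \<noteq> 0 \<and> (\<forall>j. 1 \<le> j \<and> j < l \<longrightarrow> \<beta> j = 0)"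
  then have "\<not> l < k" using assms(4)[of l] by blast
  moreover have "\<not> k < l" using l assms(1,3) by blast
  ultimately show "l = k" by simp
qed

text \<open>For even order the leading index is only bounded below, so existence is needed
  separately; the least positive index with nonzero \<beta> provides it.\<close>

lemma leading_index_props:
  assumes "1 \<le> s" "\<beta> s \<noteq> 0"
  shows "1 \<le> leading_index s \<beta>" "\<beta> (leading_index s \<beta>) \<noteq> 0"
proof -
  define k where "k = (LEAST k. 1 \<le> k \<and> \<beta> k \<noteq> 0)"
  have k: "1 \<le> k \<and> \<beta> k \<noteq> 0"
    using assms LeastI[of "\<lambda>k. 1 \<le> k \<and> \<beta> k \<noteq> 0" s] unfolding k_def by blast
  have "k \<le> s"
    using assms Least_le[of "\<lambda>k. 1 \<le> k \<and> \<beta> k \<noteq> 0" s] unfolding k_def by blast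
  moreover have "\<beta> j = 0" if "1 \<le> j" "j < k" for j
    using not_less_Least[of j "\<lambda>k. 1 \<le> k \<and> \<beta> k \<noteq> 0"] that unfolding k_def by blast
  ultimately have "leading_index s \<beta> = k" using k by (intro leading_index_eqI) blast+
  with k show "1 \<le> leading_index s \<beta>" "\<beta> (leading_index s \<beta>) \<noteq> 0" by auto
qed

section \<open>Solving the recursion for a method of linear order \<open>p\<close>\<close>

theorem lemma4p1:
  fixes s p :: nat and \<alpha> \<beta> :: "nat \<Rightarrow> real" and \<gamma> :: "nat \<Rightarrow> nat \<Rightarrow> real"
  assumes "explicit_RK s \<alpha>"
    and "has_linear_order \<alpha> p"
    and "energy_equality s \<alpha> \<beta> \<gamma>"
  shows "\<beta> 0 = 1 \<and>
    (odd p \<longrightarrow>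
      leading_index s \<beta> = (p + 1) div 2 \<and>
      \<beta> (leading_index s \<beta>) =
        (-1) ^ leading_index s \<beta> * 2 * (\<alpha> (p + 1) - 1 / fact (p + 1)) \<and>
      (\<forall>i j. i \<le> leading_index s \<beta> - 1 \<and> j \<le> leading_index s \<beta> - 1 \<longrightarrow>
        \<gamma> i j = - 1 / (fact i * fact j * real (i + j + 1)))) \<and>
    (even p \<longrightarrow>
      leading_index s \<beta> \<ge> p div 2 + 1 \<and>
      \<beta> (p div 2 + 1) =
        (-1) ^ (p div 2 + 1) * 2 *
          (\<alpha> (p + 2) - \<alpha> (p + 1) + 1 / (fact p * real (p + 2))) \<and>
      (\<forall>i j. i \<le> p div 2 \<and> j \<le> p div 2 \<longrightarrow>
        \<gamma> i j = - 1 / (fact i * fact j * real (i + j + 1)) + iota \<alpha> p i j))"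
proof -
  have s: "s \<ge> 1" and \<alpha>0: "\<alpha> 0 = 1" and \<alpha>s: "\<alpha> s \<noteq> 0" and \<alpha>_out: "\<And>k. k > s \<Longrightarrow> \<alpha> k = 0"
    using assms(1) by (auto simp: explicit_RK_def)
  have p: "p \<ge> 1" and \<alpha>_le: "\<And>k. k \<le> p \<Longrightarrow> \<alpha> k = 1 / fact k"
    and \<alpha>_p1: "\<alpha> (p + 1) \<noteq> 1 / fact (p + 1)"
    using assms(2) by (auto simp: has_linear_order_def)
  have ps: "p \<le> s" using \<alpha>_le[of p] \<alpha>_out[of p] by fastforce
  define g where "g = (\<lambda>i j. if i < s \<and> j < s then \<gamma> i j else 0)"
  have g_sym: "g i j = g j i" for i j
    using assms(3) by (auto simp: g_def energy_equality_def)
  have eqs: "\<alpha> i * \<alpha> j = (if i = j then \<beta> i else 0)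
      - (case i of 0 \<Rightarrow> 0 | Suc k \<Rightarrow> g k j) - (case j of 0 \<Rightarrow> 0 | Suc k \<Rightarrow> g i k)"
    if "i \<le> s" "j \<le> s" for i j
    using coefficient_equations[OF assms(3) _ that, of g] by (simp add: g_def)
  have \<beta>0: "\<beta> 0 = 1" using eqs[of 0 0] \<alpha>0 by simp
  have g_0: "g i 0 = - \<alpha> (Suc i)" for i
    using eqs[of "Suc i" 0] \<alpha>0 \<alpha>_out[of "Suc i"] by (cases "Suc i \<le> s") (auto simp: g_def)
  \<comment> \<open>Off the diagonal no \<beta> enters. Beyond \<open>s\<close> both sides vanish,
    so no bound on the indices remains.\<close>
  have g_Suc: "g (Suc i) j + g i (Suc j) = - (\<alpha> (Suc i) * \<alpha> (Suc j))" if "i \<noteq> j" for i j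
  proof (cases "Suc i \<le> s \<and> Suc j \<le> s")
    case True
    then show ?thesis using eqs[of "Suc i" "Suc j"] that by simp
  next
    case False
    then show ?thesis using \<alpha>_out[of "Suc i"] \<alpha>_out[of "Suc j"] by (auto simp: g_def)
  qed
  have \<beta>_Suc: "\<beta> (Suc k) = (\<alpha> (Suc k))\<^sup>2 + 2 * g (Suc k) k" if "Suc k \<le> s" for k
    using eqs[of "Suc k" "Suc k"] that g_sym[of k "Suc k"] by (simp add: power2_eq_square)
  have \<beta>s: "\<beta> s \<noteq> 0"
  proof -
    obtain k where k: "s = Suc k" using s by (cases s) auto
    have "g (Suc k) k = 0" using k by (simp add: g_def)
    then show ?thesis using \<beta>_Suc[of k] \<alpha>s k by simp
  qed
  \<comment> \<open>\<open>- D\<close> and \<open>- E\<close> are the constants of the homogeneous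
    solutions on the antidiagonals \<open>p\<close> and \<open>p + 1\<close>.\<close>
  define D where "D = \<alpha> (p + 1) - 1 / fact (p + 1)"
  define E where "E = \<alpha> (p + 2) - \<alpha> (p + 1) + 1 / (fact p * real (p + 2))"
  have antidiag: "g i j = - 1 / (fact i * fact j * real (m + 1)) + (-1) ^ j * C"
    \<comment> \<open>With \<open>Suc i + j = m\<close> and \<open>j \<ge> a\<close> this bound
      forces \<open>Suc i \<le> p\<close>, so the recursion only meets coefficients equal to
      reciprocal factorials.\<close>
    if le: "m \<le> p + a"
      and base: "\<And>i. i + a = m \<Longrightarrow>
        g i a = - 1 / (fact i * fact a * real (m + 1)) + (-1) ^ a * C"
      and bounds: "a \<le> j" "j \<le> i" "i + j = m" for i j a m C
  proof (rule antidiagonal_recursion[where g = g and a = a and m = m and C = C, OF _ base bounds])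
    fix i j assume "Suc i + j = m" "a \<le> j" "j < i"
    then show "g (Suc i) j + g i (Suc j) = - 1 / (fact (Suc i) * fact (Suc j))"
      using le by (simp add: g_Suc \<alpha>_le del: fact_Suc)
  qed
  have g_le: "g i j = - 1 / (fact i * fact j * real (i + j + 1))" if "j \<le> i" "i + j < p" for i j
  proof -
    have "g k 0 = - 1 / (fact k * fact 0 * real (i + j + 1)) + (-1) ^ 0 * 0" if "k + 0 = i + j" for k
      using that \<open>i + j < p\<close> by (simp add: g_0 \<alpha>_le mult.commute)
    from antidiag[where m = "i + j" and a = 0 and C = 0, OF _ this _ \<open>j \<le> i\<close> refl] show ?thesis using \<open>i + j < p\<close> by simp
  qed
  have g_lt: "g i j = - 1 / (fact i * fact j * real (i + j + 1))" if "i + j < p" for i j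
  proof (cases "j \<le> i")
    case True
    then show ?thesis using that by (rule g_le)
  next
    case False
    then have "g j i = - 1 / (fact j * fact i * real (j + i + 1))" using that by (intro g_le) auto
    then show ?thesis unfolding g_sym[of i j] by (simp add: ac_simps)
  qed
  have g_p: "g i j = - 1 / (fact i * fact j * real (i + j + 1)) - (-1) ^ j * D"
    if "j \<le> i" "i + j = p" for i j
  proof -
    have "g k 0 = - 1 / (fact k * fact 0 * real (p + 1)) + (-1) ^ 0 * - D" if "k + 0 = p" for k
      using that by (simp add: g_0 D_def mult.commute)
    from antidiag[where m = p and a = 0 and C = "- D", OF _ this _ that] show ?thesis by (simp add: that(2))
  qed
  have g_p1: "g i j = - 1 / (fact i * fact j * real (i + j + 1)) - (-1) ^ j * E"
    if "1 \<le> j" "j \<le> i" "i + j = p + 1" for i j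
  proof -
    \<comment> \<open>Column 0 cannot be the start here: the first equation on this antidiagonal
      contains \<alpha> at \<open>p + 1\<close>. It is solved by hand to give the value in column
      1.\<close>
    have "g k 1 = - 1 / (fact k * fact 1 * real (p + 1 + 1)) + (-1) ^ 1 * - E" if "k + 1 = p + 1" for k
      using g_Suc[of p 0] p that by (simp add: g_0 \<alpha>_le E_def)
    from antidiag[where m = "p + 1" and a = 1 and C = "- E", OF _ this that] show ?thesis by (simp add: that(3))
  qed
  \<comment> \<open>The square in \<open>\<beta>_Suc\<close> is exactly cancelled by twice the
    particular solution, so \<beta> measures only the homogeneous part.\<close>
  have mid: "(1 / fact (Suc k))\<^sup>2 = 2 * (1 / (fact (Suc k) * fact k * real (Suc k + k + 1)))"
    for k :: nat
  proof -
    have "real (Suc k + k + 1) = 2 * real (Suc k)" by simp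
    moreover have "(1 / (x * f))\<^sup>2 = 2 * (1 / (x * f * f * (2 * x)))" for x f :: real
      by (simp add: power2_eq_square)
    ultimately show ?thesis unfolding fact_Suc by (simp only:)
  qed
  have \<beta>_Suc': "\<beta> (Suc k) = 2 * (g (Suc k) k + 1 / (fact (Suc k) * fact k * real (Suc k + k + 1)))"
    if "Suc k \<le> p" for k
    unfolding \<beta>_Suc[OF order_trans[OF that ps]] \<alpha>_le[OF that] mid by (simp only: distrib_left add.commute)
  have \<beta>_zero: "\<beta> k = 0" if "1 \<le> k" "2 * k \<le> p" for k
  proof -
    obtain l where l: "k = Suc l" using \<open>1 \<le> k\<close> by (cases k) auto
    with that show ?thesis using \<beta>_Suc'[of l] g_lt[of "Suc l" l] by simp
  qed
  have \<gamma>_g: "\<gamma> i j = g i j" if "i < s" "j < s" for i j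
    using that by (simp add: g_def)

  show ?thesis
  proof (intro conjI impI)
    show "\<beta> 0 = 1" by (fact \<beta>0)
  next
    assume "odd p"
    then obtain l where l: "p = 2 * l + 1" by (elim oddE)
    \<comment> \<open>The entry \<open>g (Suc l) l\<close> lies on antidiagonal \<open>p\<close>,
      the first one with a nonzero homogeneous part.\<close>
    have \<beta>k: "\<beta> (Suc l) = (-1) ^ Suc l * 2 * D"
      using l \<beta>_Suc'[of l] g_p[of l "Suc l"] by simp
    moreover have "D \<noteq> 0" using \<alpha>_p1 by (simp add: D_def)
    ultimately have lead: "leading_index s \<beta> = Suc l"
      using l ps \<beta>_zero by (intro leading_index_eqI) auto
    then show "leading_index s \<beta> = (p + 1) div 2" using l by simp
    show "\<beta> (leading_index s \<beta>) =
        (-1) ^ leading_index s \<beta> * 2 * (\<alpha> (p + 1) - 1 / fact (p + 1))"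
      using \<beta>k unfolding lead D_def .
    have "g i j = - 1 / (fact i * fact j * real (i + j + 1))" if "i \<le> l" "j \<le> l" for i j
      using that l by (intro g_lt) auto
    then show "\<forall>i j. i \<le> leading_index s \<beta> - 1 \<and> j \<le> leading_index s \<beta> - 1 \<longrightarrow>
        \<gamma> i j = - 1 / (fact i * fact j * real (i + j + 1))"
      using l ps by (auto simp: lead \<gamma>_g)
  next
    assume "even p"
    then obtain l where l: "p = 2 * l" by (elim evenE)
    have l1: "1 \<le> l" using l p by simp
    show "leading_index s \<beta> \<ge> p div 2 + 1"
      using leading_index_props[OF s, of \<beta>] \<beta>s \<beta>_zero[of "leading_index s \<beta>"] l
      by (force simp: not_less_eq_eq[symmetric])
    \<comment> \<open>Here \<open>g (Suc l) l\<close> lies on antidiagonal \<open>p + 1\<close>;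
      \<open>l1\<close> ensures \<open>Suc l \<le> p\<close> and that column \<open>l\<close> is not
      column 0.\<close>
    have "\<beta> (Suc l) = (-1) ^ Suc l * 2 * E"
      using l l1 \<beta>_Suc'[of l] g_p1[of l "Suc l"] by simp
    then show "\<beta> (p div 2 + 1) = (-1) ^ (p div 2 + 1) * 2 *
          (\<alpha> (p + 2) - \<alpha> (p + 1) + 1 / (fact p * real (p + 2)))"
      using l unfolding E_def by simp
    have "g i j = - 1 / (fact i * fact j * real (i + j + 1)) + iota \<alpha> p i j"
      if "i \<le> l" "j \<le> l" for i j
    proof (cases "i = l \<and> j = l")
      case True
      \<comment> \<open>Within the square only the corner \<open>i = j = l\<close> reaches
        antidiagonal \<open>p\<close>; its homogeneous term is \<open>iota\<close>.\<close>
      then show ?thesis using g_p[of l l] l by (simp add: iota_def D_def)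
    next
      case False
      then have "i + j < p" using that l by auto
      then show ?thesis using False l g_lt[of i j] by (auto simp: iota_def)
    qed
    then show "\<forall>i j. i \<le> p div 2 \<and> j \<le> p div 2 \<longrightarrow>
        \<gamma> i j = - 1 / (fact i * fact j * real (i + j + 1)) + iota \<alpha> p i j"
      using l l1 ps by (auto simp: \<gamma>_g)
  qed
qed

end
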